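(* (Cramer's rule, Part 1) Let $(\mathcal A,\mathcal A_0,(-))$ be a $\mathcal T$-semiring triple, and $A$ an $n\times n$ matrix over $\mathcal A$. Then, for any vector $\mathbf v\in\mathcal A^{(n)}$, the vector $\mathbf w=\operatorname{adj}(A)\mathbf v$ satisfies $|A|\mathbf v\,\nabla_{(-)}\,A\mathbf w$. In particular, if $|A|$ is invertible in $\mathcal T$, then $\mathbf x:=\frac1{|A|}\operatorname{adj}(A)\mathbf v$ satisfies $\mathbf v\,\nabla_{(-)}\,A\mathbf x$.
   Context: $\mathcal T$ is a commutative multiplicative monoid with unit $1$, $\mathcal T_0=\mathcal T\cup\{0\}$. A semiring satisfies all ring axioms except existence of additive inverses ($0$ additively neutral and multiplicatively absorbing). A $\mathcal T$-semiring triple $(\mathcal A,\mathcal A_0,(-))$ consists of a semiring $\mathcal A$ containing $\mathcal T_0$, with $\mathcal T$ a multiplicative submonoid not containing $0$ acting by multiplication and $\mathcal T_0$ spanning $(\mathcal A,+)$ (so $\mathcal A$ is commutative); an additive sub-semigroup $\mathcal A_0\ni0$ closed under multiplication by $\mathcal T$, with $\mathcal A_0\cap\mathcal T_0=\{0\}$; and a negation map $(-)$: an automorphism of $(\mathcal A,+,0)$ of order $\le2$ leaving $\mathcal T$ invariant, with $1+((-)1)\in\mathcal A_0$ and $((-)a)b=(-)(ab)=a((-)b)$ for $a\in\mathcal T$, $b\in\mathcal A$. Write $b(-)b'=b+((-)b')$. Standing assumptions: for $a\in\mathcal T$, $ab\in\mathcal A_0$ implies $b\in\mathcal A_0$; $ab_1=ab_2$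 implies $b_1=b_2$; and Property N: $a_1+a_2=a_1(-)a_1$ whenever $a_1,a_2\in\mathcal T$ and $a_1+a_2\in\mathcal A_0$. $b_1\nabla_{(-)}b_2$ means $b_1(-)b_2\in\mathcal A_0$; for vectors it is defined componentwise. $|A|=\sum_{\pi\in S_n}(-)^\pi a_{\pi(1),1}\cdots a_{\pi(n),n}$, with $(-)^\pi$ the identity for even $\pi$ and $(-)$ for odd $\pi$. $\operatorname{adj}(A)$ is the matrix whose $(i,j)$ entry is $(-)^{i+j}$ applied to the determinant of the matrix obtained from $A$ by deleting row $j$ and column $i$, where $(-)^k$ is the identity for $k$ even and $(-)$ for $k$ odd. *)

theory Defs
  imports "Jordan_Normal_Form.Determinant"
begin

text \<open>
  The semiring \<open>\<A>\<close> is the whole type \<open>'a\<close>, and the set \<open>T\<close> is identified with its image in it.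
  Commutativity of the multiplication is carried by the type class. Nothing is lost by this:
  the elements of \<open>T\<close> commute with each other, and every element is a finite sum of elements of
  \<open>T \<union> {0}\<close>. Likewise \<open>0 \<noteq> 1\<close>, also part of the class, is forced by \<open>1 \<in> T\<close> and \<open>0 \<notin> T\<close>.
\<close>

locale semiring_triple =
  fixes T :: "'a::comm_semiring_1 set"
    and A0 :: "'a set"
    and neg :: "'a \<Rightarrow> 'a"
  assumes one_in_T: "1 \<in> T"
    and mult_in_T: "a \<in> T \<Longrightarrow> b \<in> T \<Longrightarrow> a * b \<in> T"
    and zero_notin_T: "0 \<notin> T"
    and T0_spans: "\<exists>xs. set xs \<subseteq> insert 0 T \<and> b = sum_list xs"
    and zero_in_A0: "0 \<in> A0"
    and add_in_A0: "b \<in> A0 \<Longrightarrow> c \<in> A0 \<Longrightarrow> b + c \<in> A0"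
    and T_mult_in_A0: "a \<in> T \<Longrightarrow> b \<in> A0 \<Longrightarrow> a * b \<in> A0"
    and A0_Int_T0: "A0 \<inter> insert 0 T = {0}"
    and neg_zero: "neg 0 = 0"
    and neg_add: "neg (b + c) = neg b + neg c"
    and neg_neg: "neg (neg b) = b"
    and neg_in_T: "a \<in> T \<Longrightarrow> neg a \<in> T"
    and one_neg_one: "1 + neg 1 \<in> A0"
    and neg_mult_left: "a \<in> T \<Longrightarrow> neg a * b = neg (a * b)"
    and neg_mult_right: "a \<in> T \<Longrightarrow> a * neg b = neg (a * b)"

locale standard_semiring_triple = semiring_triple +
  assumes A0_cancel: "a \<in> T \<Longrightarrow> a * b \<in> A0 \<Longrightarrow> b \<in> A0"
    and T_cancel: "a \<in> T \<Longrightarrow> a * b = a * c \<Longrightarrow> b = c"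
    and property_N: "a \<in> T \<Longrightarrow> a' \<in> T \<Longrightarrow> a + a' \<in> A0 \<Longrightarrow> a + a' = a + neg a"

definition nabla :: "'a::comm_semiring_1 set \<Rightarrow> ('a \<Rightarrow> 'a) \<Rightarrow> 'a \<Rightarrow> 'a \<Rightarrow> bool" where
  "nabla A0 neg b c \<longleftrightarrow> b + neg c \<in> A0"

definition nabla_vec ::
    "'a::comm_semiring_1 set \<Rightarrow> ('a \<Rightarrow> 'a) \<Rightarrow> 'a vec \<Rightarrow> 'a vec \<Rightarrow> bool" where
  "nabla_vec A0 neg u w \<longleftrightarrow>
     dim_vec u = dim_vec w \<and> (\<forall>i < dim_vec u. nabla A0 neg (u $ i) (w $ i))"

definition neg_power :: "('a \<Rightarrow> 'a) \<Rightarrow> nat \<Rightarrow> 'a \<Rightarrow> 'a" where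
  "neg_power neg k b = (if even k then b else neg b)"

definition neg_perm :: "('a \<Rightarrow> 'a) \<Rightarrow> (nat \<Rightarrow> nat) \<Rightarrow> 'a \<Rightarrow> 'a" where
  "neg_perm neg p b = (if evenperm p then b else neg b)"

text \<open>
  The library's determinant and adjugate need additive inverses, so versions with the
  negation map in place of the sign are defined here. They are meant for square matrices.
\<close>

definition triple_det :: "('a::comm_semiring_1 \<Rightarrow> 'a) \<Rightarrow> 'a mat \<Rightarrow> 'a" where
  "triple_det neg A =
     (\<Sum>p \<in> {p. p permutes {0..<dim_row A}}.
        neg_perm neg p (\<Prod>i = 0..<dim_row A. A $$ (p i, i)))"

text \<open>
  \<^const>\<open>mat_delete\<close> takes the row to be deleted first. Counting rows and columns from 0
  instead of 1 does not change the parity of \<open>i + j\<close>.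
\<close>

definition triple_adj :: "('a::comm_semiring_1 \<Rightarrow> 'a) \<Rightarrow> 'a mat \<Rightarrow> 'a mat" where
  "triple_adj neg A =
     mat (dim_row A) (dim_col A)
       (\<lambda>(i, j). neg_power neg (i + j) (triple_det neg (mat_delete A j i)))"

end

theory Submission
  imports Defs
begin

text \<open>
  The whole negation map is multiplication by the single element \<open>e = (-)1\<close>, with \<open>e * e = 1\<close>,
  because \<open>((-)1) b = (-)(1 b)\<close>. Hence \<open>x (-) x = (1 + e) * x\<close>. As \<open>T \<union> {0}\<close> spans the semiring,
  every multiple of \<open>1 + e\<close> is a sum of elements \<open>a * (1 + e)\<close> with \<open>a \<in> T \<union> {0}\<close>, so it lies in \<open>A0\<close>. This reduces the
  theorem to a statement about commutative semirings with an element \<open>e\<close> that serves as the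
  sign \<open>-1\<close> without being an additive inverse of \<open>1\<close>: the number \<open>|A| v\<^sub>i + e (A w)\<^sub>i\<close> is a
  multiple of \<open>1 + e\<close>.

  For this, interchange the sums in \<open>A (adj(A) v)\<close> to get \<open>(A w)\<^sub>i = \<Sum>\<^sub>k D\<^sub>i\<^sub>k v\<^sub>k\<close>, where
  \<open>D\<^sub>i\<^sub>k = \<Sum>\<^sub>j A\<^sub>i\<^sub>j adj(A)\<^sub>j\<^sub>k\<close>. By expansion along row \<open>k\<close> (lemma \<open>row_expansion_adj\<close>), \<open>D\<^sub>i\<^sub>k\<close> is
  the determinant of \<open>A\<close> with row \<open>k\<close> replaced by row \<open>i\<close>. This is \<open>|A|\<close> for \<open>k = i\<close>. For
  \<open>k \<noteq> i\<close> the matrix has two equal rows, so the terms of its determinant pair off under a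
  transposition of these rows, each pair contributing \<open>x + e x\<close> (lemma \<open>det_equal_rows\<close>).
  Altogether \<open>|A| v\<^sub>i + e (A w)\<^sub>i\<close> is \<open>(1 + e) |A| v\<^sub>i\<close> plus multiples of \<open>1 + e\<close>.
  Divisibility by \<open>1 + e\<close> survives multiplication by any \<open>c\<close>, and \<open>c |A| = 1\<close> turns the
  statement about \<open>w\<close> into the one about \<open>x = c w\<close>.
\<close>

section \<open>Determinants with a formal sign\<close>

lemma triple_adj_carrier: "A \<in> carrier_mat n n \<Longrightarrow> triple_adj f A \<in> carrier_mat n n"
  by (simp add: triple_adj_def)

text \<open>
  Without subtraction, identities in which \<open>x + e * x\<close> would vanish over a ring
  become divisibility statements with divisor \<open>1 + e\<close>.
\<close>

locale formal_sign =
  fixes e :: "'a::comm_semiring_1"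
  assumes square: "e * e = 1"
begin

definition perm_sign :: "(nat \<Rightarrow> nat) \<Rightarrow> 'a" where
  "perm_sign p = (if evenperm p then 1 else e)"

lemma power_parity: "e ^ k = (if even k then 1 else e)"
  by (induction k) (auto simp: square)

lemma triple_det_perm_sign:
  assumes "A \<in> carrier_mat n n"
  shows "triple_det ((*) e) A =
    (\<Sum>p \<in> {p. p permutes {0..<n}}. perm_sign p * (\<Prod>i = 0..<n. A $$ (p i, i)))"
  using assms unfolding triple_det_def neg_perm_def perm_sign_def
  by (intro sum.cong) auto

lemma triple_adj_power:
  assumes "A \<in> carrier_mat n n" "j < n" "k < n"
  shows "triple_adj ((*) e) A $$ (j, k) = e ^ (j + k) * triple_det ((*) e) (mat_delete A k j)"
  using assms by (simp add: triple_adj_def neg_power_def power_parity)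

lemma perm_sign_insert:
  assumes "q permutes {0..<m}" "j < Suc m" "k < Suc m"
  shows "perm_sign (permutation_insert j k q) = e ^ (j + k) * perm_sign q"
proof -
  have "sign (permutation_insert j k q) = (-1::int) ^ (j + k) * sign q"
    using signof_permutation_insert[OF assms, where ?'a = int] by simp
  then have "evenperm (permutation_insert j k q) \<longleftrightarrow> (even (j + k) \<longleftrightarrow> evenperm q)"
    by (cases "even (j + k)") (simp_all add: sign_def split: if_splits)
  then show ?thesis
    by (auto simp: perm_sign_def power_parity square)
qed

text \<open>
  The permutations of \<open>m\<close> points, which index the terms of a minor, are turned into those of
  \<open>m + 1\<close> points sending \<open>j\<close> to \<open>k\<close>. The factor \<open>e ^ (j + k)\<close> in the adjugate is exactly the
  change of sign caused by this insertion.
\<close>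

lemma signed_minor_expansion:
  assumes A: "A \<in> carrier_mat (Suc m) (Suc m)" and j: "j < Suc m" and k: "k < Suc m"
  shows "e ^ (j + k) * triple_det ((*) e) (mat_delete A k j) =
    (\<Sum>p \<in> {p. p permutes {0..<Suc m} \<and> p j = k}.
       perm_sign p * (\<Prod>i \<in> {0..<Suc m} - {j}. A $$ (p i, i)))"
proof -
  let ?Q = "{q. q permutes {0..<m}}"
  let ?h = "\<lambda>p. perm_sign p * (\<Prod>i \<in> {0..<Suc m} - {j}. A $$ (p i, i))"
  have D: "mat_delete A k j \<in> carrier_mat m m"
    using mat_delete_carrier[OF A] by simp
  have term_eq: "?h (permutation_insert j k q) =
      e ^ (j + k) * (perm_sign q * (\<Prod>i = 0..<m. mat_delete A k j $$ (q i, i)))"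
    if q: "q permutes {0..<m}" for q
  proof -
    have "(\<Prod>i \<in> {0..<Suc m} - {j}. A $$ (permutation_insert j k q i, i)) =
        (\<Prod>i \<in> insert_index j ` {0..<m}. A $$ (permutation_insert j k q i, i))"
      using insert_index_image[OF j] by simp
    also have "\<dots> = (\<Prod>i = 0..<m. A $$ (permutation_insert j k q (insert_index j i), insert_index j i))"
      by (simp add: prod.reindex[OF insert_index_inj_on])
    also have "\<dots> = (\<Prod>i = 0..<m. mat_delete A k j $$ (q i, i))"
    proof (rule prod.cong)
      fix i assume i: "i \<in> {0..<m}"
      then have "q i < m" using permutes_in_image[OF q, of i] by simp
      moreover have "permutation_insert j k q (insert_index j i) = insert_index k (q i)"
        by (simp add: permutation_insert_expand insert_index_def)
      ultimately show "A $$ (permutation_insert j k q (insert_index j i), insert_index j i) =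
          mat_delete A k j $$ (q i, i)"
        using mat_delete_index[OF A k j, of "q i" i] i by simp
    qed simp
    finally show ?thesis
      by (simp add: perm_sign_insert[OF q j k] mult.assoc)
  qed
  have "sum ?h {p. p permutes {0..<Suc m} \<and> p j = k} = sum ?h (permutation_insert j k ` ?Q)"
    using permutation_fix[OF j k] by simp
  also have "\<dots> = (\<Sum>q \<in> ?Q. ?h (permutation_insert j k q))"
    using sum.reindex[OF permutation_insert_inj_on[OF j k], of ?h] by (simp add: o_def)
  also have "\<dots> = (\<Sum>q \<in> ?Q. e ^ (j + k) * (perm_sign q * (\<Prod>i = 0..<m. mat_delete A k j $$ (q i, i))))"
    using term_eq by (intro sum.cong) auto
  also have "\<dots> = e ^ (j + k) * triple_det ((*) e) (mat_delete A k j)"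
    by (simp add: triple_det_perm_sign[OF D] sum_distrib_left)
  finally show ?thesis by simp
qed

text \<open>
  Every permutation takes the value \<open>k\<close> at exactly one \<open>j\<close>. Sorting the terms of the determinant
  by this \<open>j\<close> gives the Laplace expansion along row \<open>k\<close>, and column \<open>k\<close> of the adjugate does not
  involve the entries of that row. So they may be replaced by arbitrary \<open>c j\<close>.
\<close>

lemma row_expansion_adj:
  assumes A: "A \<in> carrier_mat n n" and k: "k < n"
  shows "(\<Sum>j = 0..<n. c j * triple_adj ((*) e) A $$ (j, k)) =
    triple_det ((*) e) (mat n n (\<lambda>(r, j). if r = k then c j else A $$ (r, j)))"
proof -
  obtain m where n: "n = Suc m" using k by (cases n) auto
  let ?N = "{0..<n}"
  let ?B = "mat n n (\<lambda>(r, j). if r = k then c j else A $$ (r, j))"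
  let ?h = "\<lambda>p. perm_sign p * (\<Prod>i \<in> ?N. ?B $$ (p i, i))"
  have summand: "c j * triple_adj ((*) e) A $$ (j, k) = sum ?h {p. p permutes ?N \<and> p j = k}"
    if j: "j \<in> ?N" for j
  proof -
    have "c j * (perm_sign p * (\<Prod>i \<in> ?N - {j}. A $$ (p i, i))) = ?h p"
      if p: "p permutes ?N" and pj: "p j = k" for p
    proof -
      have "?B $$ (p i, i) = A $$ (p i, i)" if i: "i \<in> ?N - {j}" for i
      proof -
        have "p i \<noteq> k" using i pj injD[OF permutes_inj[OF p], of i j] by auto
        moreover have "p i < n" using i permutes_in_image[OF p, of i] by simp
        ultimately show ?thesis using i by simp
      qed
      moreover have "(\<Prod>i \<in> ?N. ?B $$ (p i, i)) = ?B $$ (p j, j) * (\<Prod>i \<in> ?N - {j}. ?B $$ (p i, i))"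
        using j by (intro prod.remove) auto
      moreover have "?B $$ (p j, j) = c j" using j k pj by simp
      ultimately have "(\<Prod>i \<in> ?N. ?B $$ (p i, i)) = c j * (\<Prod>i \<in> ?N - {j}. A $$ (p i, i))"
        by (metis (no_types, lifting) prod.cong)
      then show ?thesis by (simp only: mult.left_commute)
    qed
    then have "sum ?h {p. p permutes ?N \<and> p j = k} =
        (\<Sum>p \<in> {p. p permutes ?N \<and> p j = k}.
          c j * (perm_sign p * (\<Prod>i \<in> ?N - {j}. A $$ (p i, i))))"
      by (intro sum.cong) auto
    also have "\<dots> = c j * (e ^ (j + k) * triple_det ((*) e) (mat_delete A k j))"
      using signed_minor_expansion[of A m j k] A j k unfolding n
      by (simp only: sum_distrib_left atLeastLessThan_iff)
    also have "\<dots> = c j * triple_adj ((*) e) A $$ (j, k)"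
      using triple_adj_power[OF A _ k, of j] j by simp
    finally show ?thesis by simp
  qed
  have "triple_det ((*) e) ?B = sum ?h {p. p permutes ?N}"
    by (rule triple_det_perm_sign) simp
  also have "\<dots> = sum ?h (\<Union>j \<in> ?N. {p. p permutes ?N \<and> p j = k})"
    using permutation_split_ran[of k ?N] k by simp
  also have "\<dots> = (\<Sum>j \<in> ?N. sum ?h {p. p permutes ?N \<and> p j = k})"
    using k permutation_disjoint_dom[of _ ?N _ k] finite_permutations[of ?N]
    by (intro sum.UNION_disjoint) auto
  also have "\<dots> = (\<Sum>j = 0..<n. c j * triple_adj ((*) e) A $$ (j, k))"
    using summand by (intro sum.cong) auto
  finally show ?thesis by simp
qed

text \<open>
  Composition with the transposition \<open>(i k)\<close> matches even with odd permutations and, since the rows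
  agree, keeps the product of entries. The determinant is therefore \<open>1 + e\<close> times its even part.
\<close>

lemma det_equal_rows:
  assumes B: "B \<in> carrier_mat n n" and i: "i < n" and k: "k < n" and ik: "i \<noteq> k"
    and rows: "\<And>j. j < n \<Longrightarrow> B $$ (i, j) = B $$ (k, j)"
  shows "1 + e dvd triple_det ((*) e) B"
proof -
  let ?N = "{0..<n}"
  let ?t = "transpose i k"
  let ?g = "\<lambda>p. \<Prod>j \<in> ?N. B $$ (p j, j)"
  let ?even = "{p. p permutes ?N \<and> evenperm p}"
  let ?odd = "{p. p permutes ?N \<and> \<not> evenperm p}"
  have t: "?t permutes ?N" using i k by (intro permutes_swap_id) auto
  have g: "?g (?t \<circ> p) = ?g p" for p
    using rows by (intro prod.cong) (auto simp: transpose_def)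
  have parity: "evenperm (?t \<circ> p) \<longleftrightarrow> \<not> evenperm p" if "p permutes ?N" for p
    using that t ik evenperm_comp[of ?t p] evenperm_swap[of i k]
    by (metis permutation_permutes permutation_swap_id finite_atLeastLessThan)
  have odd_eq: "sum ?g ?odd = sum ?g ?even"
  proof (rule sum.reindex_bij_witness[of _ "(\<circ>) ?t" "(\<circ>) ?t"])
    show "?g (?t \<circ> p) = ?g p" for p by (rule g)
  qed (simp_all add: parity permutes_compose[OF _ t] flip: comp_assoc)
  have "triple_det ((*) e) B = (\<Sum>p \<in> ?even \<union> ?odd. perm_sign p * ?g p)"
    unfolding triple_det_perm_sign[OF B] by (intro sum.cong) auto
  also have "\<dots> = (\<Sum>p \<in> ?even. perm_sign p * ?g p) + (\<Sum>p \<in> ?odd. perm_sign p * ?g p)"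
    by (intro sum.union_disjoint) (auto simp: finite_permutations)
  also have "\<dots> = sum ?g ?even + e * sum ?g ?odd"
    by (simp add: perm_sign_def sum_distrib_left)
  also have "\<dots> = (1 + e) * sum ?g ?even"
    by (simp add: odd_eq distrib_right)
  finally show ?thesis by simp
qed

section \<open>Cramer's rule modulo quasi-zeros\<close>

lemma cramer_dvd:
  assumes A: "A \<in> carrier_mat n n" and v: "v \<in> carrier_vec n" and i: "i < n"
  shows "1 + e dvd triple_det ((*) e) A * v $ i
           + e * (A *\<^sub>v (triple_adj ((*) e) A *\<^sub>v v)) $ i"
proof -
  let ?adj = "triple_adj ((*) e) A"
  let ?d = "triple_det ((*) e) A"
  define D where "D = (\<lambda>k. \<Sum>j = 0..<n. A $$ (i, j) * ?adj $$ (j, k))"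
  have adj: "?adj \<in> carrier_mat n n" by (rule triple_adj_carrier[OF A])
  have "(A *\<^sub>v (?adj *\<^sub>v v)) $ i = (\<Sum>j = 0..<n. A $$ (i, j) * (\<Sum>k = 0..<n. ?adj $$ (j, k) * v $ k))"
    using A adj v i by (auto simp: scalar_prod_def intro!: sum.cong)
  also have "\<dots> = (\<Sum>j = 0..<n. \<Sum>k = 0..<n. A $$ (i, j) * ?adj $$ (j, k) * v $ k)"
    by (simp add: sum_distrib_left mult.assoc)
  also have "\<dots> = (\<Sum>k = 0..<n. D k * v $ k)"
    by (subst sum.swap) (simp add: D_def sum_distrib_right)
  also have "\<dots> = D i * v $ i + (\<Sum>k \<in> {0..<n} - {i}. D k * v $ k)"
    using i by (intro sum.remove) auto
  finally have Aw: "(A *\<^sub>v (?adj *\<^sub>v v)) $ i = \<dots>" .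
  have "mat n n (\<lambda>(r, j). if r = i then A $$ (i, j) else A $$ (r, j)) = A"
    using A by (intro eq_matI) auto
  then have diag: "D i = ?d"
    unfolding D_def row_expansion_adj[OF A i] by simp
  have offdiag: "1 + e dvd D k" if "k \<in> {0..<n} - {i}" for k
    using that i unfolding D_def
    by (subst row_expansion_adj[OF A], simp) (intro det_equal_rows[of _ n i k], auto)
  have "?d * v $ i + e * (A *\<^sub>v (?adj *\<^sub>v v)) $ i =
      (1 + e) * (?d * v $ i) + e * (\<Sum>k \<in> {0..<n} - {i}. D k * v $ k)"
    unfolding Aw diag by (simp add: algebra_simps)
  moreover have "1 + e dvd (\<Sum>k \<in> {0..<n} - {i}. D k * v $ k)"
    by (rule dvd_sum) (rule dvd_mult2[OF offdiag])
  then have "1 + e dvd e * (\<Sum>k \<in> {0..<n} - {i}. D k * v $ k)"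
    by (rule dvd_mult)
  ultimately show ?thesis
    using dvd_add[OF dvd_triv_left] by simp
qed

end

section \<open>The negation map of a triple as a formal sign\<close>

context semiring_triple
begin

lemma neg_eq_mult: "neg = (*) (neg 1)"
proof
  fix b
  have "neg b = neg (1 * b)" by simp
  also have "\<dots> = neg 1 * b" by (rule neg_mult_left[OF one_in_T, symmetric])
  finally show "neg b = neg 1 * b" .
qed

lemma formal_sign_neg_one: "formal_sign (neg 1)"
proof
  show "neg 1 * neg 1 = 1"
    using neg_mult_left[OF one_in_T, of "neg 1"] neg_neg[of 1] by simp
qed

text \<open>
  \<open>A0\<close> absorbs multiplication by \<open>T\<close> only, so the cofactor is written as a sum of elements
  of \<open>T \<union> {0}\<close>.
\<close>

lemma quasi_zero_in_A0:
  assumes "1 + neg 1 dvd x"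
  shows "x \<in> A0"
proof -
  obtain b where b: "x = (1 + neg 1) * b" using assms by (rule dvdE)
  obtain xs where xs: "set xs \<subseteq> insert 0 T" "b = sum_list xs" using T0_spans by blast
  have "(1 + neg 1) * sum_list xs \<in> A0"
    using xs(1)
  proof (induction xs)
    case Nil
    show ?case by (simp add: zero_in_A0)
  next
    case (Cons a xs)
    then have "a * (1 + neg 1) \<in> A0"
      using T_mult_in_A0[OF _ one_neg_one, of a] zero_in_A0 by (cases "a = 0") auto
    moreover have "(1 + neg 1) * sum_list xs \<in> A0"
      using Cons by simp
    ultimately have "a * (1 + neg 1) + (1 + neg 1) * sum_list xs \<in> A0"
      by (rule add_in_A0)
    then show ?case by (simp add: distrib_left mult.commute)
  qed
  then show ?thesis using b xs(2) by simp
qed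

end

theorem theorem10:
  fixes T A0 :: "'a::comm_semiring_1 set"
    and neg :: "'a \<Rightarrow> 'a"
    and n :: nat
    and A :: "'a mat"
    and v :: "'a vec"
  assumes "standard_semiring_triple T A0 neg"
    and "A \<in> carrier_mat n n"
    and "v \<in> carrier_vec n"
  shows "nabla_vec A0 neg (triple_det neg A \<cdot>\<^sub>v v) (A *\<^sub>v (triple_adj neg A *\<^sub>v v)) \<and>
    (\<forall>c. triple_det neg A \<in> T \<and> c \<in> T \<and> triple_det neg A * c = 1 \<longrightarrow>
       nabla_vec A0 neg v (A *\<^sub>v (c \<cdot>\<^sub>v (triple_adj neg A *\<^sub>v v))))"
proof -
  interpret standard_semiring_triple T A0 neg by (rule assms(1))
  interpret formal_sign "neg 1" by (rule formal_sign_neg_one)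
  note A = assms(2) and v = assms(3)
  let ?d = "triple_det neg A"
  let ?w = "triple_adj neg A *\<^sub>v v"
  have neg_mult: "neg x = neg 1 * x" for x
    by (rule fun_cong[OF neg_eq_mult])
  have dvd: "1 + neg 1 dvd ?d * v $ i + neg ((A *\<^sub>v ?w) $ i)" if "i < n" for i
    using cramer_dvd[OF A v that] unfolding neg_eq_mult[symmetric] .
  have "nabla_vec A0 neg (?d \<cdot>\<^sub>v v) (A *\<^sub>v ?w)"
    using A v dvd by (auto simp: nabla_vec_def nabla_def intro!: quasi_zero_in_A0)
  moreover have "nabla_vec A0 neg v (A *\<^sub>v (c \<cdot>\<^sub>v ?w))" if c: "?d * c = 1" for c
  proof -
    have "1 + neg 1 dvd v $ i + neg ((A *\<^sub>v (c \<cdot>\<^sub>v ?w)) $ i)" if i: "i < n" for i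
    proof -
      have "(A *\<^sub>v (c \<cdot>\<^sub>v ?w)) $ i = c * (A *\<^sub>v ?w) $ i"
        using A i by (simp add: carrier_matD(1)[OF triple_adj_carrier[OF A]])
      then have "v $ i + neg ((A *\<^sub>v (c \<cdot>\<^sub>v ?w)) $ i) = (?d * c) * v $ i + neg 1 * (c * (A *\<^sub>v ?w) $ i)"
        by (simp only: c mult_1_left neg_mult[of "c * (A *\<^sub>v ?w) $ i"])
      also have "\<dots> = c * (?d * v $ i + neg 1 * (A *\<^sub>v ?w) $ i)"
        by (simp add: algebra_simps)
      also have "\<dots> = c * (?d * v $ i + neg ((A *\<^sub>v ?w) $ i))"
        by (simp only: neg_mult[of "(A *\<^sub>v ?w) $ i"])
      finally show ?thesis using dvd[OF i] by simp
    qed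
    then show ?thesis
      using A v by (auto simp: nabla_vec_def nabla_def intro!: quasi_zero_in_A0)
  qed
  ultimately show ?thesis by blast
qed

end
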